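(* Let $G$ and $H$ be two non-rigid graphs of orders $m$ and $n$ respectively, with $G$ connected. Let $H_{1},H_{2},\ldots,H_{k}$, $k\geq 1$, be the non-trivial components of $H$. Then $$m\left(\sum_{i=1}^k fix_f(H_i)\right)\leq fix_f(G[H])\leq \frac{mn}{2}.$$
   Context: All graphs are finite, simple and undirected. A graph is rigid if its automorphism group is trivial, and non-rigid otherwise. A component is non-trivial if it has at least two vertices. The composition product $G[H]$ is the graph with vertex set $V(G)\times V(H)$ in which $(u,v)$ is adjacent to $(x,y)$ whenever $ux\in E(G)$, or $u=x$ and $vy\in E(H)$. Let $\Gamma=\Gamma(G)$ be the automorphism group of a graph $G$. For $u\in V(G)$, $O(u)$ is the $\Gamma$-orbit of $u$; for $x\in V(G)$, $\Gamma_x$ is the stabilizer of $x$ and $O_x(u)=\{\pi(u):\pi\in\Gamma_x\}$. Let $V_a(G)=\{(u,v): u\neq v,\ O(u)=O(v)\}$. For vertices $u,v$ let $F(u,v)=\{x\in V(G):O_x(u)\neq O_x(v)\}$. A function $g:V(G)\to[0,1]$ is a fixing function of $G$ if $\sum_{x\in F(u,v)}g(x)\ge 1$ for every $(u,v)\in V_a(G)$. Put $|g|=\sum_{x\in V(G)}g(x)$. The fractional fixing number $fix_f(G)$ is the minimum of $|g|$ over all fixing functions $g$ of $G$ (so it is $0$ if $G$ is rigid). *)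

theory Defs
  imports "HOL-Analysis.Analysis" "Graph_Theory.Graph_Theory"
begin

(*
  A finite simple undirected graph is a digraph record satisfying the locale
  predicate graph: finite, loop-free, without parallel arcs, with symmetric
  arc set. The undirected edge uv is the pair of arcs (u,v), (v,u), and
  adjacency of u and v is u \<rightarrow>\<^bsub>G\<^esub> v.
*)

(* Permutations are the identity off the vertex set, so that
   distinct elements of this set are distinct automorphisms. *)
definition automorphisms :: "('a,'b) pre_digraph \<Rightarrow> ('a \<Rightarrow> 'a) set" where
  "automorphisms G = {\<pi>. \<pi> permutes verts G \<and>
     (\<forall>u\<in>verts G. \<forall>v\<in>verts G. u \<rightarrow>\<^bsub>G\<^esub> v \<longleftrightarrow> \<pi> u \<rightarrow>\<^bsub>G\<^esub> \<pi> v)}"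

definition rigid :: "('a,'b) pre_digraph \<Rightarrow> bool" where
  "rigid G \<longleftrightarrow> automorphisms G = {id}"

definition vertex_orbit :: "('a,'b) pre_digraph \<Rightarrow> 'a \<Rightarrow> 'a set" where
  "vertex_orbit G u = {\<pi> u |\<pi>. \<pi> \<in> automorphisms G}"

definition vertex_stabilizer :: "('a,'b) pre_digraph \<Rightarrow> 'a \<Rightarrow> ('a \<Rightarrow> 'a) set" where
  "vertex_stabilizer G x = {\<pi> \<in> automorphisms G. \<pi> x = x}"

definition stabilizer_orbit :: "('a,'b) pre_digraph \<Rightarrow> 'a \<Rightarrow> 'a \<Rightarrow> 'a set" where
  "stabilizer_orbit G x u = {\<pi> u |\<pi>. \<pi> \<in> vertex_stabilizer G x}"

definition V_a :: "('a,'b) pre_digraph \<Rightarrow> ('a \<times> 'a) set" where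
  "V_a G = {(u,v). u \<in> verts G \<and> v \<in> verts G \<and> u \<noteq> v \<and> vertex_orbit G u = vertex_orbit G v}"

definition fixing_set :: "('a,'b) pre_digraph \<Rightarrow> 'a \<Rightarrow> 'a \<Rightarrow> 'a set" where
  "fixing_set G u v = {x \<in> verts G. stabilizer_orbit G x u \<noteq> stabilizer_orbit G x v}"

(* The values of g off the vertex set are irrelevant. *)
definition fixing_function :: "('a,'b) pre_digraph \<Rightarrow> ('a \<Rightarrow> real) \<Rightarrow> bool" where
  "fixing_function G g \<longleftrightarrow> (\<forall>x\<in>verts G. g x \<in> {0..1}) \<and>
     (\<forall>(u,v)\<in>V_a G. (\<Sum>x\<in>fixing_set G u v. g x) \<ge> 1)"

(* The infimum is attained, see fix_f_attained below. *)
definition fix_f :: "('a,'b) pre_digraph \<Rightarrow> real" where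
  "fix_f G = Inf {\<Sum>x\<in>verts G. g x |g. fixing_function G g}"

(* A maximal connected subdigraph of a symmetric digraph is induced, hence
   symmetric again. Digraph_Component.connected requires a vertex. *)
definition components_of_graph :: "('a,'b) pre_digraph \<Rightarrow> ('a,'b) pre_digraph set" where
  "components_of_graph G = {C. pre_digraph.max_subgraph G Digraph_Component.connected C}"

definition nontrivial_components :: "('a,'b) pre_digraph \<Rightarrow> ('a,'b) pre_digraph set" where
  "nontrivial_components G = {C \<in> components_of_graph G. card (verts C) \<ge> 2}"

definition composition_product ::
    "('a,'c) pre_digraph \<Rightarrow> ('b,'d) pre_digraph \<Rightarrow> ('a \<times> 'b, ('a \<times> 'b) \<times> ('a \<times> 'b)) pre_digraph" where
  "composition_product G H = with_proj
     \<lparr> pverts = verts G \<times> verts H,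
       parcs = {((u,v),(x,y)) | u v x y.
         (u,v) \<in> verts G \<times> verts H \<and> (x,y) \<in> verts G \<times> verts H \<and>
         (u \<rightarrow>\<^bsub>G\<^esub> x \<or> u = x \<and> v \<rightarrow>\<^bsub>H\<^esub> y)} \<rparr>"

lemma graph_composition_product:
  assumes "graph G" "graph H"
  shows "graph (composition_product G H)"
proof -
  interpret G: graph G by fact
  interpret H: graph H by fact
  let ?P = "\<lparr> pverts = verts G \<times> verts H,
       parcs = {((u,v),(x,y)) | u v x y.
         (u,v) \<in> verts G \<times> verts H \<and> (x,y) \<in> verts G \<times> verts H \<and>
         (u \<rightarrow>\<^bsub>G\<^esub> x \<or> u = x \<and> v \<rightarrow>\<^bsub>H\<^esub> y)} \<rparr>"
  have fin: "finite (parcs ?P)"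
    by (rule finite_subset[of _ "(verts G \<times> verts H) \<times> (verts G \<times> verts H)"]) auto
  have "pair_graph ?P"
    using fin G.adj_not_same H.adj_not_same G.graph_symmetric H.graph_symmetric
    by unfold_locales (auto simp: symmetric_def intro!: symI)
  then show ?thesis
    unfolding composition_product_def by (rule pair_graph.pair_graphD_graph)
qed

lemma fixing_function_one:
  assumes "graph G"
  shows "fixing_function G (\<lambda>_. 1)"
proof -
  interpret graph G by fact
  have "1 \<le> (\<Sum>x\<in>fixing_set G u v. 1 :: real)" if "(u,v) \<in> V_a G" for u v
  proof -
    have uv: "u \<in> verts G" "u \<noteq> v"
      using that by (auto simp: V_a_def)
    have "id \<in> vertex_stabilizer G u"
      by (auto simp: vertex_stabilizer_def automorphisms_def permutes_id)
    then have "v \<in> stabilizer_orbit G u v"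
      unfolding stabilizer_orbit_def by (intro CollectI exI[of _ id]) simp
    moreover have "v \<notin> stabilizer_orbit G u u"
      using uv by (auto simp: stabilizer_orbit_def vertex_stabilizer_def)
    ultimately have u: "u \<in> fixing_set G u v"
      using uv unfolding fixing_set_def by auto
    have fin: "finite (fixing_set G u v)"
      by (simp add: fixing_set_def)
    have "card (fixing_set G u v) \<noteq> 0"
      using u fin by auto
    then show ?thesis
      by simp
  qed
  then show ?thesis
    by (auto simp: fixing_function_def)
qed

lemma fix_f_attained:
  assumes "graph G"
  shows "\<exists>g. fixing_function G g \<and> (\<Sum>x\<in>verts G. g x) = fix_f G"
    and "\<And>g. fixing_function G g \<Longrightarrow> fix_f G \<le> (\<Sum>x\<in>verts G. g x)"
proof -
  interpret graph G by fact
  define B where "B = PiE UNIV (\<lambda>x. if x \<in> verts G then {0..1::real} else {0})"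
  define K where "K = B \<inter> (\<Inter>(u,v)\<in>V_a G. {g. 1 \<le> (\<Sum>x\<in>fixing_set G u v. g x)})"
  define W where "W = {\<Sum>x\<in>verts G. g x |g. fixing_function G g}"
  have cont: "continuous_on UNIV (\<lambda>g :: 'a \<Rightarrow> real. \<Sum>x\<in>S. g x)" for S
    by (intro continuous_intros continuous_on_product_coordinates)
  have "compactin (product_topology (\<lambda>_. euclidean) UNIV) B"
    unfolding B_def compactin_PiE by auto
  then have "compact B"
    by (simp add: euclidean_product_topology)
  moreover have "closed (\<Inter>(u,v)\<in>V_a G. {g :: 'a \<Rightarrow> real. 1 \<le> (\<Sum>x\<in>fixing_set G u v. g x)})"
    by (intro closed_INT) (auto intro: closed_Collect_le cont)
  ultimately have "compact K"
    unfolding K_def by (rule compact_Int_closed)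
  have W: "W = (\<lambda>g. \<Sum>x\<in>verts G. g x) ` K"
  proof (intro equalityI subsetI)
    fix w assume "w \<in> W"
    then obtain g where g: "fixing_function G g" "w = (\<Sum>x\<in>verts G. g x)"
      by (auto simp: W_def)
    define h where "h x = (if x \<in> verts G then g x else 0)" for x
    have "(\<Sum>x\<in>S. h x) = (\<Sum>x\<in>S. g x)" if "S \<subseteq> verts G" for S
      by (rule sum.cong) (use that in \<open>auto simp: h_def\<close>)
    moreover have "fixing_set G u v \<subseteq> verts G" for u v
      by (auto simp: fixing_set_def)
    moreover have "h \<in> B"
      using g by (auto simp: B_def h_def fixing_function_def)
    ultimately have "h \<in> K" "w = (\<Sum>x\<in>verts G. h x)"
      using g by (auto simp: K_def fixing_function_def)
    then show "w \<in> (\<lambda>g. \<Sum>x\<in>verts G. g x) ` K"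
      by blast
  next
    fix w assume "w \<in> (\<lambda>g. \<Sum>x\<in>verts G. g x) ` K"
    then obtain g where g: "g \<in> K" "w = (\<Sum>x\<in>verts G. g x)"
      by auto
    have "g x \<in> {0..1}" if "x \<in> verts G" for x
    proof -
      have "g x \<in> (if x \<in> verts G then {0..1} else {0})"
        using g(1) by (auto simp only: K_def B_def PiE_iff Int_iff)
      then show ?thesis
        using that by simp
    qed
    then have "fixing_function G g"
      using g(1) by (auto simp: fixing_function_def K_def)
    then show "w \<in> W"
      using g(2) by (auto simp: W_def)
  qed
  have "compact W"
    unfolding W using \<open>compact K\<close>
    by (intro compact_continuous_image continuous_on_subset[OF cont]) auto
  moreover have "W \<noteq> {}"
    using fixing_function_one[OF assms] by (auto simp: W_def)
  ultimately have "Inf W \<in> W" "bdd_below W"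
    by (auto intro!: closed_contains_Inf compact_imp_closed bounded_imp_bdd_below
        compact_imp_bounded)
  moreover have "fix_f G = Inf W"
    by (simp add: fix_f_def W_def)
  ultimately show "\<exists>g. fixing_function G g \<and> (\<Sum>x\<in>verts G. g x) = fix_f G"
    and "\<And>g. fixing_function G g \<Longrightarrow> fix_f G \<le> (\<Sum>x\<in>verts G. g x)"
    by (auto simp: W_def intro!: cInf_lower)
qed

end

theory Submission
  imports Defs
begin

text \<open>
  Both bounds rest on one criterion: a vertex \<open>x\<close> lies outside \<open>F(u,v)\<close> exactly when
  some automorphism fixes \<open>x\<close> and carries \<open>u\<close> to \<open>v\<close>
  (\<open>fixing_set_iff\<close>).

  For the upper bound, an automorphism that carries \<open>u\<close> to \<open>v \<noteq> u\<close> fixes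
  neither of them, so \<open>u\<close> and \<open>v\<close> both lie in \<open>F(u,v)\<close>, and the constant
  function with value one half is a fixing function of any graph
  (\<open>fix_f_le_half_order\<close>).

  For the lower bound, consider the vertices \<open>(a,y)\<close> of \<open>G[H]\<close> with \<open>a\<close>
  fixed and \<open>y\<close> in a component \<open>C\<close> of \<open>H\<close>. They induce a copy of
  \<open>C\<close>, and every other vertex of \<open>G[H]\<close> is adjacent to all of them or to none, so
  every automorphism of \<open>C\<close> extends by the identity to an automorphism of
  \<open>G[H]\<close>. These extensions show that \<open>F((a,u),(a,v))\<close> in \<open>G[H]\<close> is
  contained in the copy of the set \<open>F(u,v)\<close> of \<open>C\<close>
  (\<open>fixing_set_homogeneous_copy\<close>). Hence a fixing function of \<open>G[H]\<close> restricts
  to a fixing function on every copy; since the copies for the different pairs \<open>(a,C)\<close> are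
  disjoint, their weights add up (\<open>sum_fix_f_homogeneous_copies_le\<close>).
\<close>

section \<open>Orbits\<close>

lemma automorphisms_permutes: "\<pi> \<in> automorphisms G \<Longrightarrow> \<pi> permutes verts G"
  by (simp add: automorphisms_def)

lemma automorphism_adj_iff:
  "\<lbrakk>\<pi> \<in> automorphisms G; u \<in> verts G; v \<in> verts G\<rbrakk> \<Longrightarrow> \<pi> u \<rightarrow>\<^bsub>G\<^esub> \<pi> v \<longleftrightarrow> u \<rightarrow>\<^bsub>G\<^esub> v"
  by (simp add: automorphisms_def)

lemma id_in_automorphisms: "id \<in> automorphisms G"
  by (simp add: automorphisms_def permutes_id)

lemma comp_in_automorphisms:
  assumes "\<pi> \<in> automorphisms G" "\<rho> \<in> automorphisms G"
  shows "\<pi> \<circ> \<rho> \<in> automorphisms G"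
proof -
  have "\<rho> u \<in> verts G \<longleftrightarrow> u \<in> verts G" for u
    using permutes_in_image[OF automorphisms_permutes[OF assms(2)]] .
  then have "u \<rightarrow>\<^bsub>G\<^esub> v \<longleftrightarrow> (\<pi> \<circ> \<rho>) u \<rightarrow>\<^bsub>G\<^esub> (\<pi> \<circ> \<rho>) v"
    if "u \<in> verts G" "v \<in> verts G" for u v
    using that automorphism_adj_iff[OF assms(1)] automorphism_adj_iff[OF assms(2)] by simp
  then show ?thesis
    using permutes_compose[OF automorphisms_permutes automorphisms_permutes, OF assms(2,1)]
    unfolding automorphisms_def by blast
qed

lemma inv_in_automorphisms:
  assumes "\<pi> \<in> automorphisms G"
  shows "inv \<pi> \<in> automorphisms G"
proof -
  have p: "\<pi> permutes verts G"
    using assms by (rule automorphisms_permutes)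
  have "inv \<pi> u \<rightarrow>\<^bsub>G\<^esub> inv \<pi> v \<longleftrightarrow> u \<rightarrow>\<^bsub>G\<^esub> v" if "u \<in> verts G" "v \<in> verts G" for u v
  proof -
    have "inv \<pi> u \<in> verts G" "inv \<pi> v \<in> verts G"
      using that permutes_in_image[OF permutes_inv[OF p]] by auto
    from automorphism_adj_iff[OF assms this] show ?thesis
      by (simp add: permutes_inverses[OF p])
  qed
  then show ?thesis
    unfolding automorphisms_def using permutes_inv[OF p] by blast
qed

lemma id_in_vertex_stabilizer: "id \<in> vertex_stabilizer G x"
  by (simp add: vertex_stabilizer_def id_in_automorphisms)

lemma comp_in_vertex_stabilizer:
  "\<lbrakk>\<pi> \<in> vertex_stabilizer G x; \<rho> \<in> vertex_stabilizer G x\<rbrakk> \<Longrightarrow> \<pi> \<circ> \<rho> \<in> vertex_stabilizer G x"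
  by (simp add: vertex_stabilizer_def comp_in_automorphisms)

lemma inv_in_vertex_stabilizer:
  assumes "\<pi> \<in> vertex_stabilizer G x"
  shows "inv \<pi> \<in> vertex_stabilizer G x"
  using assms inv_in_automorphisms[of \<pi> G] permutes_inv_eq[OF automorphisms_permutes, of \<pi> G x x]
  by (simp add: vertex_stabilizer_def)

text \<open>
  Orbits partition the points, so two of them coincide as soon as they meet. Stated for a set of
  permutations with the closure properties of a group, this serves both the full automorphism group
  and the vertex stabilizers.
\<close>
lemma orbit_eq_iff:
  assumes "id \<in> A"
    and comp: "\<And>\<pi> \<rho>. \<pi> \<in> A \<Longrightarrow> \<rho> \<in> A \<Longrightarrow> \<pi> \<circ> \<rho> \<in> A"
    and inv: "\<And>\<pi>. \<pi> \<in> A \<Longrightarrow> inv \<pi> \<in> A"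
    and bij: "\<And>\<pi>. \<pi> \<in> A \<Longrightarrow> bij \<pi>"
  shows "{\<pi> u |\<pi>. \<pi> \<in> A} = {\<pi> v |\<pi>. \<pi> \<in> A} \<longleftrightarrow> (\<exists>\<pi>\<in>A. \<pi> u = v)"
proof
  assume eq: "{\<pi> u |\<pi>. \<pi> \<in> A} = {\<pi> v |\<pi>. \<pi> \<in> A}"
  have "v \<in> {\<pi> v |\<pi>. \<pi> \<in> A}"
    using \<open>id \<in> A\<close> by (intro CollectI exI[of _ id]) simp
  then have "v \<in> {\<pi> u |\<pi>. \<pi> \<in> A}"
    by (simp only: eq)
  then show "\<exists>\<pi>\<in>A. \<pi> u = v"
    by auto
next
  assume "\<exists>\<pi>\<in>A. \<pi> u = v"
  then obtain \<sigma> where \<sigma>: "\<sigma> \<in> A" "\<sigma> u = v"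
    by blast
  \<comment> \<open>Composing with \<open>\<sigma>\<close> and with its inverse translates one orbit into the other.\<close>
  then have "inv \<sigma> v = u"
    using bij by (auto simp: bij_is_inj)
  have "\<pi> u \<in> {\<pi> v |\<pi>. \<pi> \<in> A}" if "\<pi> \<in> A" for \<pi>
    using comp[OF that inv[OF \<sigma>(1)]] \<open>inv \<sigma> v = u\<close>
    by (intro CollectI exI[of _ "\<pi> \<circ> inv \<sigma>"]) simp
  moreover have "\<pi> v \<in> {\<pi> u |\<pi>. \<pi> \<in> A}" if "\<pi> \<in> A" for \<pi>
    using comp[OF that \<sigma>(1)] \<sigma>(2)
    by (intro CollectI exI[of _ "\<pi> \<circ> \<sigma>"]) simp
  ultimately show "{\<pi> u |\<pi>. \<pi> \<in> A} = {\<pi> v |\<pi>. \<pi> \<in> A}"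
    by blast
qed

lemma vertex_orbit_eq_iff:
  "vertex_orbit G u = vertex_orbit G v \<longleftrightarrow> (\<exists>\<pi>\<in>automorphisms G. \<pi> u = v)"
  unfolding vertex_orbit_def
  by (rule orbit_eq_iff[OF id_in_automorphisms comp_in_automorphisms inv_in_automorphisms
        permutes_bij[OF automorphisms_permutes]])

lemma stabilizer_orbit_eq_iff:
  "stabilizer_orbit G x u = stabilizer_orbit G x v \<longleftrightarrow>
    (\<exists>\<pi>\<in>automorphisms G. \<pi> x = x \<and> \<pi> u = v)"
proof -
  have stab: "\<pi> \<in> automorphisms G" if "\<pi> \<in> vertex_stabilizer G x" for \<pi>
    using that by (simp add: vertex_stabilizer_def)
  have "stabilizer_orbit G x u = stabilizer_orbit G x v \<longleftrightarrow> (\<exists>\<pi>\<in>vertex_stabilizer G x. \<pi> u = v)"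
    unfolding stabilizer_orbit_def
    by (rule orbit_eq_iff[OF id_in_vertex_stabilizer comp_in_vertex_stabilizer
          inv_in_vertex_stabilizer permutes_bij[OF automorphisms_permutes[OF stab]]])
  then show ?thesis
    by (auto simp: vertex_stabilizer_def)
qed

lemma V_a_iff:
  "(u,v) \<in> V_a G \<longleftrightarrow>
    u \<in> verts G \<and> v \<in> verts G \<and> u \<noteq> v \<and> (\<exists>\<pi>\<in>automorphisms G. \<pi> u = v)"
  by (auto simp: V_a_def vertex_orbit_eq_iff)

lemma fixing_set_iff:
  "x \<in> fixing_set G u v \<longleftrightarrow>
    x \<in> verts G \<and> \<not> (\<exists>\<pi>\<in>automorphisms G. \<pi> x = x \<and> \<pi> u = v)"
  by (simp add: fixing_set_def stabilizer_orbit_eq_iff)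

section \<open>The upper bound\<close>

text \<open>
  An automorphism that fixes \<open>u\<close> or \<open>v\<close> cannot carry \<open>u\<close> to
  \<open>v \<noteq> u\<close>. Hence every fixing set has at least the two elements \<open>u\<close> and
  \<open>v\<close>, and weight one half on each vertex suffices.
\<close>
lemma fix_f_le_half_order:
  assumes "graph G"
  shows "fix_f G \<le> card (verts G) / 2"
proof -
  interpret graph G by fact
  have "1 \<le> (\<Sum>x\<in>fixing_set G u v. 1/2 :: real)" if "(u,v) \<in> V_a G" for u v
  proof -
    have uv: "u \<in> verts G" "v \<in> verts G" "u \<noteq> v"
      using that by (auto simp: V_a_iff)
    have "\<pi> v \<noteq> v" if "\<pi> \<in> automorphisms G" "\<pi> u = v" for \<pi>
      using uv that permutes_inj[OF automorphisms_permutes] by (metis injD)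
    then have "{u,v} \<subseteq> fixing_set G u v"
      using uv by (auto simp: fixing_set_iff)
    moreover have "finite (fixing_set G u v)"
      by (simp add: fixing_set_def)
    ultimately have "card {u,v} \<le> card (fixing_set G u v)"
      by (intro card_mono)
    then show ?thesis
      using uv by simp
  qed
  then have "fixing_function G (\<lambda>_. 1/2)"
    by (auto simp: fixing_function_def)
  from fix_f_attained(2)[OF assms this] show ?thesis
    by simp
qed

section \<open>Homogeneous copies\<close>

text \<open>
  The image of \<open>f\<close> is an induced copy of \<open>Y\<close> in \<open>X\<close> and a module of
  \<open>X\<close>: a vertex outside it does not distinguish its elements. Only one direction of
  adjacency is recorded, so the notion is meant for symmetric \<open>X\<close>.
\<close>
definition homogeneous_copy ::
    "('a,'c) pre_digraph \<Rightarrow> ('b,'d) pre_digraph \<Rightarrow> ('b \<Rightarrow> 'a) \<Rightarrow> bool" where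
  "homogeneous_copy X Y f \<longleftrightarrow>
     inj_on f (verts Y) \<and> f ` verts Y \<subseteq> verts X \<and>
     (\<forall>u\<in>verts Y. \<forall>v\<in>verts Y. f u \<rightarrow>\<^bsub>X\<^esub> f v \<longleftrightarrow> u \<rightarrow>\<^bsub>Y\<^esub> v) \<and>
     (\<forall>z\<in>verts X - f ` verts Y. \<forall>u\<in>verts Y. \<forall>v\<in>verts Y. z \<rightarrow>\<^bsub>X\<^esub> f u \<longleftrightarrow> z \<rightarrow>\<^bsub>X\<^esub> f v)"

text \<open>
  Automorphisms of a module extend by the identity: the adjacencies between the module and the rest
  of the graph do not depend on the vertex of the module. Here \<^term>\<open>map_permutation\<close> is
  the conjugate by \<open>f\<close>, extended by the identity.
\<close>
lemma map_permutation_in_automorphisms: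
  assumes X: "graph X" and copy: "homogeneous_copy X Y f" and \<pi>: "\<pi> \<in> automorphisms Y"
  shows "map_permutation (verts Y) f \<pi> \<in> automorphisms X"
proof -
  interpret graph X by fact
  let ?\<rho> = "map_permutation (verts Y) f \<pi>"
  have inj: "inj_on f (verts Y)" and img: "f ` verts Y \<subseteq> verts X"
    and adj: "\<And>u v. \<lbrakk>u \<in> verts Y; v \<in> verts Y\<rbrakk> \<Longrightarrow> f u \<rightarrow>\<^bsub>X\<^esub> f v \<longleftrightarrow> u \<rightarrow>\<^bsub>Y\<^esub> v"
    and out: "\<And>z u v. \<lbrakk>z \<in> verts X; z \<notin> f ` verts Y; u \<in> verts Y; v \<in> verts Y\<rbrakk> \<Longrightarrow>
      z \<rightarrow>\<^bsub>X\<^esub> f u \<longleftrightarrow> z \<rightarrow>\<^bsub>X\<^esub> f v"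
    using copy unfolding homogeneous_copy_def by blast+
  have p: "\<pi> permutes verts Y"
    using \<pi> by (rule automorphisms_permutes)
  have mem: "\<pi> u \<in> verts Y \<longleftrightarrow> u \<in> verts Y" for u
    by (rule permutes_in_image[OF p])
  have on: "?\<rho> (f u) = f (\<pi> u)" if "u \<in> verts Y" for u
    using that inj by (rule map_permutation_apply[rotated])
  have off: "?\<rho> z = z" if "z \<notin> f ` verts Y" for z
    using that by (auto simp: map_permutation_def restrict_id_def)
  have "?\<rho> permutes f ` verts Y"
    using inj p by (intro map_permutation_permutes inj_on_imp_bij_betw)
  then have "?\<rho> permutes verts X"
    using img by (rule permutes_subset)
  moreover have "x \<rightarrow>\<^bsub>X\<^esub> y \<longleftrightarrow> ?\<rho> x \<rightarrow>\<^bsub>X\<^esub> ?\<rho> y" if xy: "x \<in> verts X" "y \<in> verts X" for x y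
  proof (cases "x \<in> f ` verts Y"; cases "y \<in> f ` verts Y")
    assume "x \<in> f ` verts Y" "y \<in> f ` verts Y"
    then obtain u v where "u \<in> verts Y" "x = f u" "v \<in> verts Y" "y = f v"
      by blast
    then show ?thesis
      using automorphism_adj_iff[OF \<pi>] by (simp add: on adj mem)
  next
    assume x: "x \<in> f ` verts Y" and y: "y \<notin> f ` verts Y"
    then obtain u where u: "u \<in> verts Y" "x = f u"
      by blast
    then have "y \<rightarrow>\<^bsub>X\<^esub> x \<longleftrightarrow> y \<rightarrow>\<^bsub>X\<^esub> ?\<rho> x"
      using out[OF xy(2) y, of u "\<pi> u"] by (simp add: on mem)
    then show ?thesis
      using off[OF y] graph_symmetric by auto
  next
    assume x: "x \<notin> f ` verts Y" and y: "y \<in> f ` verts Y"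
    then obtain v where v: "v \<in> verts Y" "y = f v"
      by blast
    then show ?thesis
      using out[OF xy(1) x, of v "\<pi> v"] off[OF x] by (simp add: on mem)
  next
    assume "x \<notin> f ` verts Y" "y \<notin> f ` verts Y"
    then show ?thesis
      by (simp add: off)
  qed
  ultimately show ?thesis
    by (simp add: automorphisms_def)
qed

text \<open>
  A vertex outside the copy is fixed by the extension of an automorphism that carries \<open>u\<close> to
  \<open>v\<close>, and a vertex of the copy outside the fixing set of \<open>u\<close> and \<open>v\<close>
  in \<open>Y\<close> is fixed by the extension of a suitable one.
\<close>
lemma fixing_set_homogeneous_copy:
  assumes X: "graph X" and copy: "homogeneous_copy X Y f" and uv: "(u,v) \<in> V_a Y"
  shows "fixing_set X (f u) (f v) \<subseteq> f ` fixing_set Y u v"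
proof
  fix z assume z: "z \<in> fixing_set X (f u) (f v)"
  have inj: "inj_on f (verts Y)"
    using copy by (simp add: homogeneous_copy_def)
  have u: "u \<in> verts Y"
    using uv by (simp add: V_a_iff)
  have moved: "map_permutation (verts Y) f \<pi> z \<noteq> z" if "\<pi> \<in> automorphisms Y" "\<pi> u = v" for \<pi>
    using z map_permutation_in_automorphisms[OF X copy that(1)] map_permutation_apply[OF inj u, of \<pi>]
      that(2) by (auto simp: fixing_set_iff)
  obtain \<pi> where "\<pi> \<in> automorphisms Y" "\<pi> u = v"
    using uv by (auto simp: V_a_iff)
  from moved[OF this] have "z \<in> f ` verts Y"
    by (auto simp: map_permutation_def restrict_id_def split: if_splits)
  then obtain y where y: "y \<in> verts Y" "z = f y"
    by blast
  then have "\<pi> y \<noteq> y" if "\<pi> \<in> automorphisms Y" "\<pi> u = v" for \<pi>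
    using moved[OF that] map_permutation_apply[OF inj y(1), of \<pi>] by auto
  then have "y \<in> fixing_set Y u v"
    using y(1) by (auto simp: fixing_set_iff)
  then show "z \<in> f ` fixing_set Y u v"
    using y(2) by blast
qed

lemma fixing_function_homogeneous_copy:
  assumes X: "graph X" and Y: "graph Y" and copy: "homogeneous_copy X Y f"
    and g: "fixing_function X g"
  shows "fixing_function Y (g \<circ> f)"
proof -
  interpret Y: graph Y by fact
  have inj: "inj_on f (verts Y)" and img: "\<And>u. u \<in> verts Y \<Longrightarrow> f u \<in> verts X"
    using copy unfolding homogeneous_copy_def by blast+
  have g01: "\<And>x. x \<in> verts X \<Longrightarrow> 0 \<le> g x \<and> g x \<le> 1"
    and g1: "\<And>x y. (x,y) \<in> V_a X \<Longrightarrow> 1 \<le> (\<Sum>z\<in>fixing_set X x y. g z)"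
    using g by (auto simp: fixing_function_def)
  have "1 \<le> (\<Sum>y\<in>fixing_set Y u v. (g \<circ> f) y)" if uv: "(u,v) \<in> V_a Y" for u v
  proof -
    have mem: "u \<in> verts Y" "v \<in> verts Y" "u \<noteq> v"
      using uv by (auto simp: V_a_iff)
    obtain \<pi> where \<pi>: "\<pi> \<in> automorphisms Y" "\<pi> u = v"
      using uv by (auto simp: V_a_iff)
    have sub: "fixing_set Y u v \<subseteq> verts Y"
      by (auto simp: fixing_set_def)
    have "(f u, f v) \<in> V_a X"
      using mem img inj_onD[OF inj] map_permutation_in_automorphisms[OF X copy \<pi>(1)]
        map_permutation_apply[OF inj mem(1), of \<pi>] \<pi>(2)
      by (auto simp: V_a_iff)
    then have "1 \<le> (\<Sum>z\<in>fixing_set X (f u) (f v). g z)"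
      by (rule g1)
    also have "\<dots> \<le> (\<Sum>z\<in>f ` fixing_set Y u v. g z)"
      using fixing_set_homogeneous_copy[OF X copy uv] sub img g01
      by (intro sum_mono2 finite_imageI finite_subset[OF sub]) auto
    also have "\<dots> = (\<Sum>y\<in>fixing_set Y u v. (g \<circ> f) y)"
      using inj_on_subset[OF inj sub] by (rule sum.reindex)
    finally show ?thesis .
  qed
  then show ?thesis
    using g01 img by (auto simp: fixing_function_def)
qed

text \<open>
  A minimum fixing function of \<open>X\<close> restricts to a fixing function on each of the disjoint
  copies, so its weight is at least the sum of their fractional fixing numbers.
\<close>
lemma sum_fix_f_homogeneous_copies_le:
  assumes X: "graph X" and "finite I" and Y: "\<And>i. i \<in> I \<Longrightarrow> graph (Y i)"
    and copy: "\<And>i. i \<in> I \<Longrightarrow> homogeneous_copy X (Y i) (f i)"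
    and disj: "\<And>i j. \<lbrakk>i \<in> I; j \<in> I; i \<noteq> j\<rbrakk> \<Longrightarrow> f i ` verts (Y i) \<inter> f j ` verts (Y j) = {}"
  shows "(\<Sum>i\<in>I. fix_f (Y i)) \<le> fix_f X"
proof -
  interpret X: graph X by fact
  obtain g where g: "fixing_function X g" "(\<Sum>x\<in>verts X. g x) = fix_f X"
    using fix_f_attained(1)[OF X] by blast
  have img: "f i ` verts (Y i) \<subseteq> verts X" and inj: "inj_on (f i) (verts (Y i))" if "i \<in> I" for i
    using copy[OF that] unfolding homogeneous_copy_def by blast+
  have "(\<Sum>i\<in>I. fix_f (Y i)) \<le> (\<Sum>i\<in>I. \<Sum>y\<in>verts (Y i). (g \<circ> f i) y)"
    by (rule sum_mono) (rule fix_f_attained(2)[OF Y fixing_function_homogeneous_copy[OF X Y copy g(1)]])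
  also have "\<dots> = (\<Sum>i\<in>I. \<Sum>x\<in>f i ` verts (Y i). g x)"
    by (rule sum.cong) (simp_all only: sum.reindex[OF inj])
  also have "\<dots> = (\<Sum>x\<in>(\<Union>i\<in>I. f i ` verts (Y i)). g x)"
    using \<open>finite I\<close> disj finite_subset[OF img X.finite_verts]
    by (intro sum.UNION_disjoint[symmetric]) blast+
  also have "\<dots> \<le> (\<Sum>x\<in>verts X. g x)"
    using g(1) img by (intro sum_mono2) (auto simp: fixing_function_def)
  finally show ?thesis
    using g(2) by simp
qed

section \<open>Components of a symmetric digraph\<close>

text \<open>
  In a symmetric digraph connectedness and strong connectedness agree on induced subgraphs, and a
  maximal connected subgraph is induced because adding arcs preserves connectedness.
\<close>
lemma components_of_graph_subset_sccs:
  assumes "sym_digraph H"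
  shows "components_of_graph H \<subseteq> pre_digraph.sccs H"
proof
  interpret sym_digraph H by fact
  fix C assume "C \<in> components_of_graph H"
  then have C: "max_subgraph Digraph_Component.connected C"
    by (simp add: components_of_graph_def)
  have "arc_mono Digraph_Component.connected"
    unfolding arc_mono_def
    by (metis spanning_def subgraphE wf_digraph.connected_spanning_imp_connected)
  with C have "induced_subgraph C H"
    by (rule induced_subgraphI_arc_mono)
  then interpret C: sym_digraph C
    by (rule induced_graph_imp_graph)
  have "strongly_connected C"
    using C.sym_arcs max_subgraph_prop[OF C] by (rule C.symmetric_connected_imp_strongly_connected)
  moreover have "Digraph_Component.connected D" if "strongly_connected D" for D :: "('a,'b) pre_digraph"
    using that rtrancl_on_mono[of "arcs_ends D" "(arcs_ends D)\<^sup>s" "verts D" "verts D"]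
    by (auto simp: connected_conv strongly_connected_def reachable_def symcl_def)
  ultimately have "max_subgraph strongly_connected C"
    using C by (blast intro: max_subgraph_mp)
  then show "C \<in> sccs"
    by (simp add: sccs_altdef2)
qed

text \<open>An arc out of \<open>C\<close> could be walked back, so its head belongs to the same class.\<close>
lemma scc_closed_under_adjacency:
  assumes "sym_digraph H" and C: "C \<in> pre_digraph.sccs H" and "u \<in> verts C" "u \<rightarrow>\<^bsub>H\<^esub> v"
  shows "v \<in> verts C"
proof -
  interpret sym_digraph H by fact
  have "verts C \<in> sccs_verts"
    using C by (simp add: sccs_verts_conv)
  moreover have "u \<rightarrow>\<^sup>*\<^bsub>H\<^esub> v" "v \<rightarrow>\<^sup>*\<^bsub>H\<^esub> u"
    using reachable_adjI \<open>u \<rightarrow>\<^bsub>H\<^esub> v\<close> graph_symmetric[OF \<open>u \<rightarrow>\<^bsub>H\<^esub> v\<close>] by blast+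
  ultimately show ?thesis
    using \<open>u \<in> verts C\<close> unfolding in_sccs_verts_conv_reachable by blast
qed

lemma induced_subgraph_adj_iff:
  assumes "induced_subgraph C H" "u \<in> verts C" "v \<in> verts C"
  shows "u \<rightarrow>\<^bsub>C\<^esub> v \<longleftrightarrow> u \<rightarrow>\<^bsub>H\<^esub> v"
  using assms by (auto simp: arcs_ends_conv induced_subgraph_def subgraph_def compatible_def)

lemma (in graph) graph_induced:
  assumes "induced_subgraph C G"
  shows "graph C"
proof -
  interpret C: digraph C
    using assms by (rule digraphI_induced)
  show ?thesis
    using induced_graph_imp_symmetric[OF sym_arcs assms] by (rule C.graphI)
qed

section \<open>The composition product\<close>

lemma verts_composition_product: "verts (composition_product G H) = verts G \<times> verts H"
  by (simp add: composition_product_def)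

lemma composition_product_adj_iff:
  "(u,v) \<rightarrow>\<^bsub>composition_product G H\<^esub> (x,y) \<longleftrightarrow>
    u \<in> verts G \<and> v \<in> verts H \<and> x \<in> verts G \<and> y \<in> verts H \<and> (u \<rightarrow>\<^bsub>G\<^esub> x \<or> u = x \<and> v \<rightarrow>\<^bsub>H\<^esub> y)"
  by (auto simp: composition_product_def)

text \<open>
  A vertex in another copy of \<open>H\<close> is adjacent to all or to none of the vertices of the copy
  at \<open>a\<close>, and a vertex of this copy outside \<open>C\<close> is adjacent to no vertex of
  \<open>C\<close>.
\<close>
lemma homogeneous_copy_component:
  assumes G: "graph G" and H: "graph H" and "a \<in> verts G" and C: "C \<in> pre_digraph.sccs H"
  shows "homogeneous_copy (composition_product G H) C (Pair a)"
proof -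
  interpret G: graph G by fact
  interpret H: graph H by fact
  have ind: "induced_subgraph C H"
    using C by (rule H.in_sccs_imp_induced)
  then have sub: "verts C \<subseteq> verts H"
    by auto
  have cl: "v \<in> verts C" if "u \<in> verts C" "v \<rightarrow>\<^bsub>H\<^esub> u" for u v
    using scc_closed_under_adjacency[OF H.sym_digraph_axioms C that(1)] H.graph_symmetric[OF that(2)] .
  show ?thesis
    unfolding homogeneous_copy_def verts_composition_product
    using sub \<open>a \<in> verts G\<close> induced_subgraph_adj_iff[OF ind] cl
    by (auto simp: composition_product_adj_iff inj_on_def dest: G.adj_not_same)
qed

lemma sum_fix_f_components_le:
  assumes G: "graph G" and H: "graph H" and "finite \<C>" "\<C> \<subseteq> components_of_graph H"
  shows "card (verts G) * (\<Sum>C\<in>\<C>. fix_f C) \<le> fix_f (composition_product G H)"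
proof -
  interpret G: graph G by fact
  interpret H: graph H by fact
  have scc: "C \<in> H.sccs" if "C \<in> \<C>" for C
    using that assms(4) components_of_graph_subset_sccs[OF H.sym_digraph_axioms] by blast
  have "card (verts G) * (\<Sum>C\<in>\<C>. fix_f C) = (\<Sum>(a,C)\<in>verts G \<times> \<C>. fix_f C)"
    by (simp add: sum.cartesian_product[symmetric])
  also have "\<dots> = (\<Sum>p\<in>verts G \<times> \<C>. fix_f (snd p))"
    by (simp add: case_prod_beta)
  also have "\<dots> \<le> fix_f (composition_product G H)"
  proof (rule sum_fix_f_homogeneous_copies_le[where f = "\<lambda>p. Pair (fst p)"])
    show "graph (composition_product G H)"
      using G H by (rule graph_composition_product)
    show "finite (verts G \<times> \<C>)"
      using \<open>finite \<C>\<close> by simp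
  next
    fix p assume "p \<in> verts G \<times> \<C>"
    then show "graph (snd p)" "homogeneous_copy (composition_product G H) (snd p) (Pair (fst p))"
      using H.graph_induced[OF H.in_sccs_imp_induced[OF scc]] homogeneous_copy_component[OF G H _ scc]
      by auto
  next
    fix p q assume "p \<in> verts G \<times> \<C>" "q \<in> verts G \<times> \<C>" "p \<noteq> q"
    then show "Pair (fst p) ` verts (snd p) \<inter> Pair (fst q) ` verts (snd q) = {}"
      using H.scc_disj[OF scc scc] by (cases p; cases q) auto
  qed
  finally show ?thesis .
qed

theorem theorem6p5:
  fixes G :: "('a,'c) pre_digraph" and H :: "('b,'d) pre_digraph"
    and m n k :: nat and Hs :: "nat \<Rightarrow> ('b,'d) pre_digraph"
  assumes "graph G" and "graph H"
    and "\<not> rigid G" and "\<not> rigid H"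
    and "card (verts G) = m" and "card (verts H) = n"
    and "Digraph_Component.connected G"
    and "k \<ge> 1" and "bij_betw Hs {1..k} (nontrivial_components H)"
  shows "real m * (\<Sum>i=1..k. fix_f (Hs i)) \<le> fix_f (composition_product G H) \<and>
    fix_f (composition_product G H) \<le> real m * real n / 2"
proof
  have "(\<Sum>i=1..k. fix_f (Hs i)) = (\<Sum>C\<in>nontrivial_components H. fix_f C)"
    using assms(9) by (rule sum.reindex_bij_betw)
  moreover have "finite (nontrivial_components H)"
    using bij_betw_finite[OF assms(9)] by simp
  moreover have "nontrivial_components H \<subseteq> components_of_graph H"
    by (auto simp: nontrivial_components_def)
  ultimately show "real m * (\<Sum>i=1..k. fix_f (Hs i)) \<le> fix_f (composition_product G H)"
    using sum_fix_f_components_le[OF assms(1,2)] assms(5) by simp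
  show "fix_f (composition_product G H) \<le> real m * real n / 2"
    using fix_f_le_half_order[OF graph_composition_product[OF assms(1,2)]] assms(5,6)
    by (simp add: verts_composition_product card_cartesian_product)
qed

end
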